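(* Let $\mathcal C=\{\mathcal C_1,\dots,\mathcal C_K\}$ be a clustering of $\{1,\dots,n\}$, and let $A$ and $B$ be $n\times n$ stochastic matrices both having inter-cluster common influence with respect to $\mathcal C$. Then $$\Delta_{\mathcal C}(AB)\le (1-\mu_{\mathcal C}(A))\,\Delta_{\mathcal C}(B).$$
   Context: A clustering of $\{1,\dots,n\}$ is a partition $\mathcal C=\{\mathcal C_1,\dots,\mathcal C_K\}$ of it. A stochastic matrix is a nonnegative square matrix with all row sums equal to $1$. A stochastic matrix $A$ has inter-cluster common influence with respect to $\mathcal C$ if for every pair $p,p'$ the sum $\sum_{j\in\mathcal C_{p'}}A_{ij}$ is the same for all $i\in\mathcal C_p$. The cluster ergodicity coefficient is $$\mu_{\mathcal C}(A)=\min_{p=1,\dots,K}\ \min_{i,j\in\mathcal C_p}\ \sum_{k=1}^n\min(A_{ik},A_{jk}).$$ Fix a norm $\|\cdot\|$ on (row) vectors. For a matrix $M$ with rows $M_1,\dots,M_n$, the cluster Hajnal diameter is $\Delta_{\mathcal C}(M)=\max_{p=1,\dots,K}\max_{i,j\in\mathcal C_p}\|M_i-M_j\|$. *)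

theory Defs
  imports "HOL-Analysis.Analysis" "HOL-Library.Disjoint_Sets"
begin

text \<open>
  The index set \<open>{1,\<dots>,n}\<close> is a finite type \<open>'n\<close>, so an \<open>n \<times> n\<close> matrix has type
  \<open>real ^ 'n ^ 'n\<close>, its entries are \<open>A $ i $ j\<close> and \<open>A $ i\<close> is its \<open>i\<close>-th row.
  A clustering is a set \<open>C\<close> with \<open>partition_on UNIV C\<close>.
\<close>

definition stochastic :: "real ^ 'n ^ 'n \<Rightarrow> bool" where
  "stochastic A \<longleftrightarrow>
     (\<forall>i j. 0 \<le> A $ i $ j) \<and> (\<forall>i. (\<Sum>j\<in>UNIV. A $ i $ j) = 1)"

definition common_influence :: "'n set set \<Rightarrow> real ^ 'n ^ 'n \<Rightarrow> bool" where
  "common_influence C A \<longleftrightarrow>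
     (\<forall>P\<in>C. \<forall>P'\<in>C. \<forall>i\<in>P. \<forall>i'\<in>P. (\<Sum>j\<in>P'. A $ i $ j) = (\<Sum>j\<in>P'. A $ i' $ j))"

text \<open>
  The minima and maxima below range over finite sets; these are nonempty whenever
  \<open>C\<close> is a partition of \<open>UNIV\<close>, since partitions have no empty blocks.
\<close>

definition cluster_ergodicity :: "'n set set \<Rightarrow> real ^ 'n ^ 'n \<Rightarrow> real" where
  "cluster_ergodicity C A =
     (MIN P\<in>C. MIN (i, j)\<in>P \<times> P. \<Sum>k\<in>UNIV. min (A $ i $ k) (A $ j $ k))"

text \<open>
  An arbitrary norm, not necessarily the Euclidean one provided by the type class
  instance. Nonnegativity follows from the three axioms.
\<close>

definition is_norm :: "('a::real_vector \<Rightarrow> real) \<Rightarrow> bool" where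
  "is_norm N \<longleftrightarrow>
     (\<forall>x. N x = 0 \<longleftrightarrow> x = 0) \<and>
     (\<forall>a x. N (a *\<^sub>R x) = \<bar>a\<bar> * N x) \<and>
     (\<forall>x y. N (x + y) \<le> N x + N y)"

definition cluster_hajnal_diameter ::
    "(real ^ 'n \<Rightarrow> real) \<Rightarrow> 'n set set \<Rightarrow> real ^ 'n ^ 'n \<Rightarrow> real" where
  "cluster_hajnal_diameter N C M =
     (MAX P\<in>C. MAX (i, j)\<in>P \<times> P. N (M $ i - M $ j))"

end

theory Submission
  imports Defs
begin

text \<open>
  For \<open>i, j\<close> in one cluster, removing the common part \<open>min A\<^sub>i\<^sub>k A\<^sub>j\<^sub>k\<close> from the rows
  \<open>A\<^sub>i\<close> and \<open>A\<^sub>j\<close> leaves nonnegative weights which, by common influence, have the same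
  mass on every cluster, and total mass at most \<open>1 - \<mu>\<^sub>C(A)\<close>. Transporting one
  weight to the other within each cluster only pairs rows of \<open>B\<close> at distance at most
  \<open>\<Delta>\<^sub>C(B)\<close>.
\<close>

lemma is_norm_zero: "is_norm N \<Longrightarrow> N 0 = 0"
  unfolding is_norm_def by blast

lemma is_norm_sum_le:
  assumes "is_norm N"
  shows "N (\<Sum>k\<in>S. f k) \<le> (\<Sum>k\<in>S. N (f k))"
proof (induction S rule: infinite_finite_induct)
  case (insert x S)
  have "N (f x + (\<Sum>k\<in>S. f k)) \<le> N (f x) + N (\<Sum>k\<in>S. f k)"
    using assms by (auto simp: is_norm_def)
  then show ?case using insert by simp
qed (use assms in \<open>auto simp: is_norm_zero\<close>)

text \<open>The product coupling \<open>a k * b l / s\<close>, where \<open>s\<close> is the common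
  mass, has marginals \<open>a\<close> and \<open>b\<close>. It therefore writes the signed
  combination as an average of differences \<open>v k - v l\<close>, each of norm at most
  \<open>D\<close>, with total weight \<open>s\<close>.\<close>

lemma is_norm_weighted_diff_le:
  fixes a b :: "'i \<Rightarrow> real" and v :: "'i \<Rightarrow> 'a::real_vector"
  assumes N: "is_norm N" and "finite Q"
    and a: "\<And>k. k \<in> Q \<Longrightarrow> 0 \<le> a k" and b: "\<And>k. k \<in> Q \<Longrightarrow> 0 \<le> b k"
    and eq: "sum a Q = sum b Q"
    and D: "\<And>k l. k \<in> Q \<Longrightarrow> l \<in> Q \<Longrightarrow> N (v k - v l) \<le> D"
  shows "N (\<Sum>k\<in>Q. (a k - b k) *\<^sub>R v k) \<le> sum a Q * D"
\<comment> \<open>The coupling divides by the mass. If the mass is zero, nonnegativity makes all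
  weights vanish and both sides are 0.\<close>
proof (cases "sum a Q = 0")
  case True
  then have "\<forall>k\<in>Q. a k = 0" "\<forall>k\<in>Q. b k = 0"
    using eq a b \<open>finite Q\<close> by (simp_all add: sum_nonneg_eq_0_iff)
  then show ?thesis using N by (simp add: is_norm_zero)
next
  case False
  define s where "s = sum a Q"
  have s: "s > 0" using False a by (simp add: s_def order_less_le sum_nonneg)
  \<comment> \<open>The coupling is kept multiplied by \<open>s\<close> to avoid fractions. Summing
    out the index absent from the vector yields \<open>sum b Q\<close> in the first term and
    \<open>sum a Q\<close> in the second, both equal to \<open>s\<close>.\<close>
  have "(\<Sum>k\<in>Q. \<Sum>l\<in>Q. (a k * b l) *\<^sub>R (v k - v l))
      = (\<Sum>k\<in>Q. \<Sum>l\<in>Q. b l *\<^sub>R (a k *\<^sub>R v k)) - (\<Sum>k\<in>Q. \<Sum>l\<in>Q. a k *\<^sub>R (b l *\<^sub>R v l))"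
    by (simp add: scaleR_diff_right sum_subtractf mult.commute)
  also have "\<dots> = s *\<^sub>R (\<Sum>k\<in>Q. a k *\<^sub>R v k) - s *\<^sub>R (\<Sum>l\<in>Q. b l *\<^sub>R v l)"
    by (simp only: scaleR_sum_left[symmetric] scaleR_sum_right[symmetric] eq[symmetric] s_def)
  finally have *: "s *\<^sub>R (\<Sum>k\<in>Q. (a k - b k) *\<^sub>R v k)
      = (\<Sum>k\<in>Q. \<Sum>l\<in>Q. (a k * b l) *\<^sub>R (v k - v l))"
    by (simp add: scaleR_diff_left scaleR_diff_right sum_subtractf)
  have "s * N (\<Sum>k\<in>Q. (a k - b k) *\<^sub>R v k) = N (s *\<^sub>R (\<Sum>k\<in>Q. (a k - b k) *\<^sub>R v k))"
    using N s by (simp add: is_norm_def)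
  also have "\<dots> \<le> (\<Sum>k\<in>Q. \<Sum>l\<in>Q. N ((a k * b l) *\<^sub>R (v k - v l)))"
    unfolding * by (rule order_trans[OF is_norm_sum_le[OF N] sum_mono[OF is_norm_sum_le[OF N]]])
  also have "\<dots> = (\<Sum>k\<in>Q. \<Sum>l\<in>Q. a k * b l * N (v k - v l))"
    using N a b by (intro sum.cong) (auto simp: is_norm_def abs_mult)
  also have "\<dots> \<le> (\<Sum>k\<in>Q. \<Sum>l\<in>Q. a k * b l * D)"
    using a b D by (intro sum_mono mult_left_mono) auto
  also have "\<dots> = s * (s * D)"
    by (simp only: s_def eq[symmetric] sum_distrib_left[symmetric] sum_distrib_right[symmetric]
        mult.assoc)
  finally show ?thesis using s by (simp add: s_def)
qed

lemma row_matrix_mult: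
  fixes A B :: "real ^ 'n ^ 'n"
  shows "(A ** B) $ i = (\<Sum>k\<in>UNIV. (A $ i $ k) *\<^sub>R (B $ k))"
  by (simp add: vec_eq_iff matrix_matrix_mult_def)

lemma hajnal_diameter_ge:
  fixes C :: "'n::finite set set"
  assumes "P \<in> C" "i \<in> P" "j \<in> P"
  shows "N (M $ i - M $ j) \<le> cluster_hajnal_diameter N C M"
proof -
  have "N (M $ i - M $ j) \<le> (MAX (i, j)\<in>P \<times> P. N (M $ i - M $ j))"
    using assms by (intro Max_ge) (auto intro!: image_eqI[of _ _ "(i, j)"])
  also have "\<dots> \<le> cluster_hajnal_diameter N C M"
    unfolding cluster_hajnal_diameter_def using assms by (intro Max_ge) auto
  finally show ?thesis .
qed

text \<open>An upper bound on \<open>Max\<close> requires a nonempty set. The partition provides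
  this at both levels: some block exists, and no block is empty.\<close>

lemma hajnal_diameter_le:
  fixes C :: "'n::finite set set"
  assumes "partition_on UNIV C"
    and "\<And>P i j. P \<in> C \<Longrightarrow> i \<in> P \<Longrightarrow> j \<in> P \<Longrightarrow> N (M $ i - M $ j) \<le> D"
  shows "cluster_hajnal_diameter N C M \<le> D"
proof -
  have C: "C \<noteq> {}" "{} \<notin> C" using assms(1) by (auto simp: partition_on_def)
  have "(MAX (i, j)\<in>P \<times> P. N (M $ i - M $ j)) \<le> D" if "P \<in> C" for P
  proof (rule Max.boundedI)
    show "(\<lambda>(i, j). N (M $ i - M $ j)) ` (P \<times> P) \<noteq> {}" using that C by auto
  qed (use assms(2)[OF that] in auto)
  then show ?thesis
    unfolding cluster_hajnal_diameter_def using C by (intro Max.boundedI) auto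
qed

lemma cluster_ergodicity_le:
  fixes C :: "'n::finite set set"
  assumes "P \<in> C" "i \<in> P" "j \<in> P"
  shows "cluster_ergodicity C A \<le> (\<Sum>k\<in>UNIV. min (A $ i $ k) (A $ j $ k))"
proof -
  have "cluster_ergodicity C A \<le> (MIN (i, j)\<in>P \<times> P. \<Sum>k\<in>UNIV. min (A $ i $ k) (A $ j $ k))"
    unfolding cluster_ergodicity_def using assms by (intro Min_le) auto
  also have "\<dots> \<le> (\<Sum>k\<in>UNIV. min (A $ i $ k) (A $ j $ k))"
    using assms by (intro Min_le) (auto intro!: image_eqI[of _ _ "(i, j)"])
  finally show ?thesis .
qed

lemma sum_partition_on:
  assumes "partition_on S C" "finite S"
  shows "sum f S = (\<Sum>P\<in>C. sum f P)"
proof -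
  have "sum f (\<Union>C) = (sum \<circ> sum) f C"
    using assms finite_subset[of _ S]
    by (intro sum.Union_disjoint) (auto simp: partition_on_def disjoint_def)
  then show ?thesis using assms(1) by (simp add: partition_on_def)
qed

theorem lemma4:
  fixes C :: "'n::finite set set"
    and A B :: "real ^ 'n ^ 'n"
    and N :: "real ^ 'n \<Rightarrow> real"
  assumes "is_norm N"
    and "partition_on UNIV C"
    and "stochastic A" and "common_influence C A"
    and "stochastic B" and "common_influence C B"
  shows "cluster_hajnal_diameter N C (A ** B)
         \<le> (1 - cluster_ergodicity C A) * cluster_hajnal_diameter N C B"
proof (rule hajnal_diameter_le[OF assms(2)])
  fix P i j assume P: "P \<in> C" "i \<in> P" "j \<in> P"
  define D where "D = cluster_hajnal_diameter N C B"
  define m where "m = (\<lambda>k. min (A $ i $ k) (A $ j $ k))"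
  define a where "a = (\<lambda>k. A $ i $ k - m k)"
  define b where "b = (\<lambda>k. A $ j $ k - m k)"
  have nonneg: "0 \<le> a k" "0 \<le> b k" for k by (auto simp: a_def b_def m_def)
  \<comment> \<open>Both rows lose the same amount \<open>sum m Q\<close> on \<open>Q\<close>, so
    equality of their cluster sums survives.\<close>
  have mass: "sum a Q = sum b Q" if "Q \<in> C" for Q
  proof -
    have "(\<Sum>k\<in>Q. A $ i $ k) = (\<Sum>k\<in>Q. A $ j $ k)"
      using assms(4) P that unfolding common_influence_def by blast
    then show ?thesis by (simp add: a_def b_def sum_subtractf)
  qed
  \<comment> \<open>The trivial pair \<open>(i, i)\<close> shows that \<open>D\<close> is
    nonnegative, as the final monotonicity step requires.\<close>
  have "D \<ge> N (B $ i - B $ i)"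
    unfolding D_def using P by (intro hajnal_diameter_ge)
  then have D: "D \<ge> 0" using assms(1) by (simp add: is_norm_zero)
  \<comment> \<open>The common part \<open>m\<close> cancels in \<open>a k - b k\<close>.\<close>
  have "(A ** B) $ i - (A ** B) $ j = (\<Sum>k\<in>UNIV. (a k - b k) *\<^sub>R (B $ k))"
    by (simp add: row_matrix_mult a_def b_def scaleR_diff_left sum_subtractf)
  also have "\<dots> = (\<Sum>Q\<in>C. \<Sum>k\<in>Q. (a k - b k) *\<^sub>R (B $ k))"
    by (rule sum_partition_on[OF assms(2)]) simp
  finally have "N ((A ** B) $ i - (A ** B) $ j)
      \<le> (\<Sum>Q\<in>C. N (\<Sum>k\<in>Q. (a k - b k) *\<^sub>R (B $ k)))"
    by (simp only: is_norm_sum_le[OF assms(1)])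
  \<comment> \<open>Splitting by clusters first ensures that only rows of \<open>B\<close> from one
    cluster are compared, so \<open>D\<close> bounds each distance.\<close>
  also have "\<dots> \<le> (\<Sum>Q\<in>C. sum a Q * D)"
    unfolding D_def
    by (intro sum_mono is_norm_weighted_diff_le assms(1) nonneg mass hajnal_diameter_ge) auto
  also have "\<dots> = sum a UNIV * D"
    by (simp add: sum_partition_on[OF assms(2), of a] sum_distrib_right)
  also have "sum a UNIV = 1 - sum m UNIV"
    using assms(3) by (simp add: a_def sum_subtractf stochastic_def)
  also have "(1 - sum m UNIV) * D \<le> (1 - cluster_ergodicity C A) * D"
    using cluster_ergodicity_le[OF P, of A] D by (intro mult_right_mono) (auto simp: m_def)
  finally show "N ((A ** B) $ i - (A ** B) $ j)
      \<le> (1 - cluster_ergodicity C A) * cluster_hajnal_diameter N C B"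
    by (simp add: D_def)
qed

end
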